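(* For every positive integer $n\geq 8$, there exists an equinumerous $4$-coloring of $[n]=\{1,2,\dots,n\}$ with no rainbow $AP(4)$.
   Context: A $k$-coloring of $[n]=\{1,\dots,n\}$ is a map $[n]\to\{1,\dots,k\}$. It is called equinumerous (balanced) if every color class has at least $\lfloor n/k\rfloor$ elements. A rainbow $AP(k)$ in a $k$-coloring of $[n]$ is an arithmetic progression $t, t+d, \dots, t+(k-1)d$ with $d\geq 1$ and all terms in $[n]$, whose $k$ terms receive $k$ pairwise distinct colors. *)

theory Defs
  imports Main "HOL-Library.FuncSet"
begin

text \<open>Colorings are total functions on the naturals; only their values on \<open>{1..n}\<close> matter.\<close>

definition coloring :: "nat \<Rightarrow> nat \<Rightarrow> (nat \<Rightarrow> nat) \<Rightarrow> bool" where
  "coloring k n c \<longleftrightarrow> c \<in> {1..n} \<rightarrow> {1..k}"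

definition equinumerous :: "nat \<Rightarrow> nat \<Rightarrow> (nat \<Rightarrow> nat) \<Rightarrow> bool" where
  "equinumerous k n c \<longleftrightarrow> (\<forall>j\<in>{1..k}. n div k \<le> card {x \<in> {1..n}. c x = j})"

definition rainbow_AP :: "nat \<Rightarrow> nat \<Rightarrow> (nat \<Rightarrow> nat) \<Rightarrow> nat \<Rightarrow> nat \<Rightarrow> bool" where
  "rainbow_AP k n c t d \<longleftrightarrow>
     d \<ge> 1 \<and> (\<forall>i<k. t + i * d \<in> {1..n}) \<and> inj_on (\<lambda>i. c (t + i * d)) {..<k}"

end

theory Submission
  imports Defs
begin

text \<open>
  Cut \<open>[n]\<close> near its middle at \<open>s\<close> and color by residue modulo 4: residues \<open>0, 1, 2, 3\<close> receive
  colors \<open>1, 1, 2, 3\<close> up to \<open>s\<close> and \<open>2, 3, 4, 4\<close> beyond.  Color 1 occurs only on the left and color 4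
  only on the right, and no 4-AP is rainbow, wherever the cut is.  For even \<open>d\<close> the progression
  meets at most two residue classes of equal parity, which carry three colors in total.  For odd
  \<open>d\<close> it runs through the four residues in cyclic order; three terms on one side can carry
  three different colors only if the remaining term repeats one of them, and two terms on each
  side never complement each other.
  A suitable cut balances the colors unless \<open>n \<equiv> 4 (mod 8)\<close>; in that case
  one color is too large by one and another too small by one, which recoloring the point \<open>n\<close> repairs.
\<close>

definition split_coloring :: "nat \<Rightarrow> nat \<Rightarrow> nat" where
  "split_coloring s x =
     (if x \<le> s then (if x mod 4 \<le> 1 then 1 else x mod 4)
      else (if x mod 4 \<ge> 2 then 4 else x mod 4 + 2))"

section \<open>Absence of rainbow progressions\<close>

lemma rainbow_AP_4D:
  assumes "rainbow_AP 4 n c t d"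
  shows "d \<ge> 1" "t \<ge> 1" "t + 3 * d \<le> n"
    and "distinct [c t, c (t + d), c (t + 2 * d), c (t + 3 * d)]"
proof -
  show "d \<ge> 1" using assms by (simp add: rainbow_AP_def)
  have range: "t + i * d \<in> {1..n}" if "i < 4" for i
    using assms that by (simp add: rainbow_AP_def)
  show "t \<ge> 1" using range[of 0] by simp
  show "t + 3 * d \<le> n" using range[of 3] by simp
  have "set [0, 1, 2, 3::nat] = {..<4}" by auto
  then have "inj_on (\<lambda>i. c (t + i * d)) (set [0, 1, 2, 3])"
    using assms by (simp only: rainbow_AP_def)
  then have "distinct (map (\<lambda>i. c (t + i * d)) [0, 1, 2, 3])"
    by (subst distinct_map) simp
  then show "distinct [c t, c (t + d), c (t + 2 * d), c (t + 3 * d)]" by simp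
qed

text \<open>A color depends only on the side of the cut and the residue. Two parameters with 16
  joint values describe all four residues, which leaves a finite check.\<close>

lemma AP_mod_4:
  fixes t d :: nat
  obtains i j where "i \<in> {0, 1, 2, 3}" "j \<in> {0, 1, 2, 3}"
    "t mod 4 = i" "(t + d) mod 4 = (i + j) mod 4"
    "(t + 2 * d) mod 4 = (i + 2 * j) mod 4" "(t + 3 * d) mod 4 = (i + 3 * j) mod 4"
proof
  show "t mod 4 \<in> {0, 1, 2, 3}" "d mod 4 \<in> {0, 1, 2, 3}" by auto
qed (rule refl | intro mod_add_cong mod_mult_cong; simp)+

lemma split_coloring_AP_not_distinct:
  "\<not> distinct [split_coloring s t, split_coloring s (t + d),
               split_coloring s (t + 2 * d), split_coloring s (t + 3 * d)]"
proof -
  obtain i j where ij: "i \<in> {0, 1, 2, 3}" "j \<in> {0, 1, 2, 3}"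
    and mods: "t mod 4 = i" "(t + d) mod 4 = (i + j) mod 4"
    "(t + 2 * d) mod 4 = (i + 2 * j) mod 4" "(t + 3 * d) mod 4 = (i + 3 * j) mod 4"
    by (rule AP_mod_4)
  \<comment> \<open>The terms never decrease, so those up to \<open>s\<close> form an initial
    segment; its length and the residues fix all four colors.\<close>
  consider "s < t" "s < t + d" "s < t + 2 * d" "s < t + 3 * d"
    | "t \<le> s" "s < t + d" "s < t + 2 * d" "s < t + 3 * d"
    | "t \<le> s" "t + d \<le> s" "s < t + 2 * d" "s < t + 3 * d"
    | "t \<le> s" "t + d \<le> s" "t + 2 * d \<le> s" "s < t + 3 * d"
    | "t \<le> s" "t + d \<le> s" "t + 2 * d \<le> s" "t + 3 * d \<le> s"
    by linarith
  then show ?thesis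
    using ij by cases (elim insertE emptyE; simp add: split_coloring_def mods)+
qed

text \<open>The last term is divisible by 4, so \<open>t\<close> and \<open>d\<close> share a
  residue \<open>j\<close> and the terms have residues \<open>j, 2j, 3j, 0\<close>. The third lies
  right of the cut: for \<open>j\<close> = 1 or 2 it has color 4 already; for \<open>j\<close> = 3
  it has color 3 and the first has 3 or 4; for \<open>j\<close> = 0 the first three use only colors
  1 and 2.\<close>

lemma recolored_AP_not_distinct:
  assumes "t + 3 * d = 8 * m + 4" "t \<ge> 1" "m \<ge> 1"
  shows "\<not> distinct [split_coloring (4 * m + 3) t, split_coloring (4 * m + 3) (t + d),
                     split_coloring (4 * m + 3) (t + 2 * d), 4]"
proof -
  obtain i j where ij: "i \<in> {0, 1, 2, 3}" "j \<in> {0, 1, 2, 3}"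
    and mods: "t mod 4 = i" "(t + d) mod 4 = (i + j) mod 4"
    "(t + 2 * d) mod 4 = (i + 2 * j) mod 4" "(t + 3 * d) mod 4 = (i + 3 * j) mod 4"
    by (rule AP_mod_4)
  have "t + 3 * d = 4 * (2 * m + 1)" using assms(1) by simp
  then have last: "(i + 3 * j) mod 4 = 0" using mods(4) by (metis mod_mult_self1_is_0)
  \<comment> \<open>Here \<open>3 * (t + 2 * d) = 2 * (8 * m + 4) + t \<ge> 16 * m + 9\<close>,
    which exceeds \<open>3 * (4 * m + 3)\<close> because \<open>m \<ge> 1\<close>.\<close>
  have right: "\<not> t + 2 * d \<le> 4 * m + 3" using assms by linarith
  show ?thesis
    using ij last by (elim insertE emptyE; simp add: split_coloring_def mods right)
qed

section \<open>Sizes of the color classes\<close>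

lemma split_coloring_eq_iff:
  "split_coloring s x = 1 \<longleftrightarrow> x \<le> s \<and> x mod 4 \<le> 1"
  "split_coloring s x = 2 \<longleftrightarrow> (if x \<le> s then x mod 4 = 2 else x mod 4 = 0)"
  "split_coloring s x = 3 \<longleftrightarrow> (if x \<le> s then x mod 4 = 3 else x mod 4 = 1)"
  "split_coloring s x = 4 \<longleftrightarrow> s < x \<and> x mod 4 \<ge> 2"
proof -
  have "x mod 4 \<in> {0, 1, 2, 3}" by auto
  then show "split_coloring s x = 1 \<longleftrightarrow> x \<le> s \<and> x mod 4 \<le> 1"
    "split_coloring s x = 2 \<longleftrightarrow> (if x \<le> s then x mod 4 = 2 else x mod 4 = 0)"
    "split_coloring s x = 3 \<longleftrightarrow> (if x \<le> s then x mod 4 = 3 else x mod 4 = 1)"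
    "split_coloring s x = 4 \<longleftrightarrow> s < x \<and> x mod 4 \<ge> 2"
    by (elim insertE emptyE; simp add: split_coloring_def)+
qed

text \<open>Each color is fed by two residue classes, so two progressions of step 4, disjoint by
  their residues, give the lower bound.\<close>

lemma card_color_class_ge:
  assumes "\<And>i. i < p \<Longrightarrow> 1 \<le> a + 4 * i \<and> a + 4 * i \<le> n \<and> c (a + 4 * i) = j"
    and "\<And>i. i < q \<Longrightarrow> 1 \<le> b + 4 * i \<and> b + 4 * i \<le> n \<and> c (b + 4 * i) = j"
    and "a mod 4 \<noteq> b mod (4::nat)"
  shows "p + q \<le> card {x \<in> {1..n}. c x = j}"
proof -
  let ?A = "(\<lambda>i. a + 4 * i) ` {..<p}" and ?B = "(\<lambda>i. b + 4 * i) ` {..<q}"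
  have "?A \<inter> ?B = {}"
  proof -
    have "a + 4 * i \<noteq> b + 4 * k" for i k
      using assms(3) by (metis mod_mult_self2)
    then show ?thesis by blast
  qed
  then have "card (?A \<union> ?B) = card ?A + card ?B"
    by (intro card_Un_disjoint) auto
  also have "\<dots> = p + q"
    by (simp add: card_image inj_on_def)
  finally have "p + q = card (?A \<union> ?B)" ..
  also have "\<dots> \<le> card {x \<in> {1..n}. c x = j}"
    using assms(1,2) by (intro card_mono) auto
  finally show ?thesis .
qed

lemma equinumerous_4I:
  assumes "n div 4 = N"
    and "\<And>j. j \<in> {1, 2, 3, 4} \<Longrightarrow> N \<le> card {x \<in> {1..n}. c x = j}"
  shows "equinumerous 4 n c"
proof -
  have "{1..4::nat} = {1, 2, 3, 4}" by auto
  then show ?thesis using assms unfolding equinumerous_def by auto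
qed

lemma coloring_split_coloring: "coloring 4 n (split_coloring s)"
proof -
  have "split_coloring s x \<in> {1..4}" for x
    using mod_less_divisor[of 4 x] by (simp add: split_coloring_def)
  then show ?thesis unfolding coloring_def by blast
qed

text \<open>Successor notation would hide the summands that are multiples of 4 from \<open>mod\<close> simplification.\<close>
declare One_nat_def [simp del] add_2_eq_Suc [simp del] add_2_eq_Suc' [simp del]

text \<open>Both \<open>{1..4 * m}\<close> and \<open>{4 * m + 1..8 * m}\<close> contain each
  residue \<open>m\<close> times; points beyond \<open>8 * m\<close> only enlarge classes.\<close>

lemma equinumerous_split_coloring_low:
  assumes "n div 4 = 2 * m"
  shows "equinumerous 4 n (split_coloring (4 * m))"
proof (rule equinumerous_4I)
  show "n div 4 = 2 * m" by (fact assms)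
  have n: "8 * m \<le> n" using assms by linarith
  fix j :: nat
  assume "j \<in> {1, 2, 3, 4}"
  then consider "j = 1" | "j = 2" | "j = 3" | "j = 4" by blast
  then show "2 * m \<le> card {x \<in> {1..n}. split_coloring (4 * m) x = j}"
  proof cases
    case 1
    have "m + m \<le> card {x \<in> {1..n}. split_coloring (4 * m) x = 1}"
      by (rule card_color_class_ge[of _ "1" _ _ _ _ "4"])
        (use n in \<open>simp_all add: split_coloring_eq_iff\<close>)
    then show ?thesis by (simp add: 1)
  next
    case 2
    have "m + m \<le> card {x \<in> {1..n}. split_coloring (4 * m) x = 2}"
      by (rule card_color_class_ge[of _ "2" _ _ _ _ "4 * m + 4"])
        (use n in \<open>simp_all add: split_coloring_eq_iff\<close>)
    then show ?thesis by (simp add: 2)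
  next
    case 3
    have "m + m \<le> card {x \<in> {1..n}. split_coloring (4 * m) x = 3}"
      by (rule card_color_class_ge[of _ "3" _ _ _ _ "4 * m + 1"])
        (use n in \<open>simp_all add: split_coloring_eq_iff\<close>)
    then show ?thesis by (simp add: 3)
  next
    case 4
    have "m + m \<le> card {x \<in> {1..n}. split_coloring (4 * m) x = 4}"
      by (rule card_color_class_ge[of _ "4 * m + 2" _ _ _ _ "4 * m + 3"])
        (use n in \<open>simp_all add: split_coloring_eq_iff\<close>)
    then show ?thesis by (simp add: 4)
  qed
qed

lemma equinumerous_split_coloring_high:
  assumes "n div 4 = 2 * m + 1" "n \<noteq> 8 * m + 4"
  shows "equinumerous 4 n (split_coloring (4 * m + 2))"
proof (rule equinumerous_4I)
  show "n div 4 = 2 * m + 1" by (fact assms)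
  have n: "8 * m + 5 \<le> n" using assms by linarith
  fix j :: nat
  assume "j \<in> {1, 2, 3, 4}"
  then consider "j = 1" | "j = 2" | "j = 3" | "j = 4" by blast
  then show "2 * m + 1 \<le> card {x \<in> {1..n}. split_coloring (4 * m + 2) x = j}"
  proof cases
    case 1
    have "(m + 1) + m \<le> card {x \<in> {1..n}. split_coloring (4 * m + 2) x = 1}"
      by (rule card_color_class_ge[of _ "1" _ _ _ _ "4"])
        (use n in \<open>simp_all add: split_coloring_eq_iff\<close>)
    then show ?thesis by (simp add: 1)
  next
    case 2
    have "(m + 1) + m \<le> card {x \<in> {1..n}. split_coloring (4 * m + 2) x = 2}"
      by (rule card_color_class_ge[of _ "2" _ _ _ _ "4 * m + 4"])
        (use n in \<open>simp_all add: split_coloring_eq_iff\<close>)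
    then show ?thesis by (simp add: 2)
  next
    case 3
    \<comment> \<open>The second progression ends at \<open>8 * m + 5\<close>, which is where
      \<open>n \<noteq> 8 * m + 4\<close> matters.\<close>
    have "m + (m + 1) \<le> card {x \<in> {1..n}. split_coloring (4 * m + 2) x = 3}"
      by (rule card_color_class_ge[of _ "3" _ _ _ _ "4 * m + 5"])
        (use n in \<open>simp_all add: split_coloring_eq_iff\<close>)
    then show ?thesis by (simp add: 3)
  next
    case 4
    have "(m + 1) + m \<le> card {x \<in> {1..n}. split_coloring (4 * m + 2) x = 4}"
      by (rule card_color_class_ge[of _ "4 * m + 3" _ _ _ _ "4 * m + 6"])
        (use n in \<open>simp_all add: split_coloring_eq_iff\<close>)
    then show ?thesis by (simp add: 4)
  qed
qed

text \<open>Before recoloring, color 2 has \<open>2 * m + 2\<close> points, among them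
  \<open>n\<close>, and color 4 has \<open>2 * m\<close>.\<close>

lemma equinumerous_recolored:
  assumes n: "n = 8 * m + 4"
  shows "equinumerous 4 n ((split_coloring (4 * m + 3))(n := 4))"
proof (rule equinumerous_4I)
  let ?c = "(split_coloring (4 * m + 3))(n := 4)"
  show "n div 4 = 2 * m + 1" using n by linarith
  fix j :: nat
  assume "j \<in> {1, 2, 3, 4}"
  then consider "j = 1" | "j = 2" | "j = 3" | "j = 4" by blast
  then show "2 * m + 1 \<le> card {x \<in> {1..n}. ?c x = j}"
  proof cases
    case 1
    have "(m + 1) + m \<le> card {x \<in> {1..n}. ?c x = 1}"
      by (rule card_color_class_ge[of _ "1" _ _ _ _ "4"])
        (use n in \<open>simp_all add: split_coloring_eq_iff\<close>)
    then show ?thesis by (simp add: 1)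
  next
    case 2
    \<comment> \<open>The second progression stops at \<open>8 * m\<close>, short of the recolored
      point.\<close>
    have "(m + 1) + m \<le> card {x \<in> {1..n}. ?c x = 2}"
      by (rule card_color_class_ge[of _ "2" _ _ _ _ "4 * m + 4"])
        (use n in \<open>simp_all add: split_coloring_eq_iff\<close>)
    then show ?thesis by (simp add: 2)
  next
    case 3
    have "(m + 1) + m \<le> card {x \<in> {1..n}. ?c x = 3}"
      by (rule card_color_class_ge[of _ "3" _ _ _ _ "4 * m + 5"])
        (use n in \<open>simp_all add: split_coloring_eq_iff\<close>)
    then show ?thesis by (simp add: 3)
  next
    case 4
    \<comment> \<open>The point \<open>n\<close> has residue 0 and lies on neither progression, so
      it is added separately.\<close>
    have "m + m \<le> card {x \<in> {1..8 * m + 3}. split_coloring (4 * m + 3) x = 4}"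
      by (rule card_color_class_ge[of _ "4 * m + 6" _ _ _ _ "4 * m + 7"])
        (simp_all add: split_coloring_eq_iff)
    moreover have "{x \<in> {1..n}. ?c x = 4} =
        insert n {x \<in> {1..8 * m + 3}. split_coloring (4 * m + 3) x = 4}"
      by (auto simp: n)
    ultimately show ?thesis by (simp add: 4 n)
  qed
qed

section \<open>Choice of the coloring according to \<open>n\<close> modulo 8\<close>

theorem theorem1p1:
  fixes n :: nat
  assumes "n \<ge> 8"
  shows "\<exists>c. coloring 4 n c \<and> equinumerous 4 n c \<and> \<not> (\<exists>t d. rainbow_AP 4 n c t d)"
proof -
  define m where "m = n div 8"
  have m: "m \<ge> 1" using assms by (simp add: m_def)
  have no_rainbow: "\<not> (\<exists>t d. rainbow_AP 4 n (split_coloring s) t d)" for s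
    using rainbow_AP_4D(4) split_coloring_AP_not_distinct by blast
  consider "n div 4 = 2 * m" | "n div 4 = 2 * m + 1" "n \<noteq> 8 * m + 4" | "n = 8 * m + 4"
    unfolding m_def by linarith
  then show ?thesis
  proof cases
    case 1
    then show ?thesis
      using coloring_split_coloring equinumerous_split_coloring_low no_rainbow by blast
  next
    case 2
    then show ?thesis
      using coloring_split_coloring equinumerous_split_coloring_high no_rainbow by blast
  next
    case 3
    define c where "c = (split_coloring (4 * m + 3))(n := 4)"
    have "coloring 4 n c"
      using coloring_split_coloring[of n "4 * m + 3"] by (auto simp: coloring_def c_def)
    moreover have "equinumerous 4 n c"
      unfolding c_def using 3 by (rule equinumerous_recolored)
    moreover have "\<not> rainbow_AP 4 n c t d" for t d
    proof
      assume "rainbow_AP 4 n c t d"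
      note d = rainbow_AP_4D(1)[OF this] and t = rainbow_AP_4D(2)[OF this]
        and le = rainbow_AP_4D(3)[OF this] and dist = rainbow_AP_4D(4)[OF this]
      \<comment> \<open>As \<open>d \<ge> 1\<close>, the first three terms are below
        \<open>n\<close>; only the last can be the recolored point.\<close>
      have c: "c t = split_coloring (4 * m + 3) t"
        "c (t + d) = split_coloring (4 * m + 3) (t + d)"
        "c (t + 2 * d) = split_coloring (4 * m + 3) (t + 2 * d)"
        using d le by (auto simp: c_def)
      show False
      proof (cases "t + 3 * d = n")
        case True
        then have "c (t + 3 * d) = 4" by (simp add: c_def)
        then show False
          using recolored_AP_not_distinct[of t d m] True 3 t m dist unfolding c by simp
      next
        case False
        then have "c (t + 3 * d) = split_coloring (4 * m + 3) (t + 3 * d)"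
          by (simp add: c_def)
        then show False
          using split_coloring_AP_not_distinct dist unfolding c by metis
      qed
    qed
    ultimately show ?thesis by blast
  qed
qed

end
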